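(* Consider the gradient method with randomized feasibility described in the context. Assume: (i) each $g_i:\mathbb{R}^n\to\mathbb{R}$ is convex, $Y$ is closed and convex, $X\cap Y\ne\emptyset$; (ii) $f(y)-f(x)\le\langle\nabla f(x),y-x\rangle+\frac L2\|y-x\|^2$ for all $x,y\in Y$, with $L>0$; (iii) $f(y)-f(x)\ge\langle\nabla f(x),y-x\rangle+\frac\mu2\|y-x\|^2$ for all $x,y\in Y$, with $\mu>0$; (iv) the step sizes satisfy $0<\alpha_k\le1/L$ for all $k\ge0$ and $\beta\in(0,2)$; (v) the random initial point satisfies $\|x_0\|\le M_0$ surely for some scalar $M_0>0$. Then the subgradients $d_k^i$ used in the randomized feasibility algorithm and the gradients $\nabla f(x_k)$ are surely bounded: there exist deterministic scalars $M_g>0$ and $M_f>0$ such that $\|d_k^i\|\le M_g$ surely for all $i=1,\dots,N_k$ and $k\ge1$, and $\|\nabla f(x_k)\|\le M_f$ surely for all $k\ge0$.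
   Context: Setting: $f,g_1,\dots,g_m:\mathbb{R}^n\to\mathbb{R}$ are convex, $f$ is differentiable, $X=\bigcap_{i=1}^m\{x\in\mathbb{R}^n: g_i(x)\le0\}$. Norms are Euclidean, $\Pi_Y$ is Euclidean projection onto $Y$, $g_i^+(x)=\max\{0,g_i(x)\}$. Randomized feasibility algorithm with input $(v_k,N_k)$, $v_k\in Y$, $N_k\in\mathbb{N}$ (deterministic or random), and fixed $\beta$: set $z_k^0=v_k$; for $i=1,\dots,N_k$ sample $\omega_k^i\in\{1,\dots,m\}$ uniformly, pick $d_k^i\in\partial g^+_{\omega_k^i}(z_k^{i-1})$ and set $z_k^i=\Pi_Y\left[z_k^{i-1}-\beta\frac{g^+_{\omega_k^i}(z_k^{i-1})}{\|d_k^i\|^2}d_k^i\right]$ (the step is zero when $g^+_{\omega_k^i}(z_k^{i-1})=0$); output $x_k=z_k^{N_k}$. Gradient method with randomized feasibility: start from a random $x_0\in Y$; for $k=0,1,2,\dots$ set $v_{k+1}=\Pi_Y[x_k-\alpha_k\nabla f(x_k)]$ and let $x_{k+1}$ be the output of the randomized feasibility algorithm with input $(v_{k+1},N_{k+1})$. "Surely" means for every realization of the randomness. *)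

theory Defs
  imports "HOL-Probability.Probability"
begin

definition subdifferential :: "('a::real_inner \<Rightarrow> real) \<Rightarrow> 'a \<Rightarrow> 'a set" where
  "subdifferential h x = {d. \<forall>y. h y \<ge> h x + d \<bullet> (y - x)}"

definition pos_part :: "('a \<Rightarrow> real) \<Rightarrow> 'a \<Rightarrow> real" where
  "pos_part h x = max 0 (h x)"

definition feasible_set :: "nat \<Rightarrow> (nat \<Rightarrow> 'a \<Rightarrow> real) \<Rightarrow> 'a set" where
  "feasible_set m g = (\<Inter>i\<in>{1..m}. {x. g i x \<le> 0})"

text \<open>One realization of the randomized feasibility algorithm with input \<open>(v, N)\<close>:
  \<open>s i\<close> is the sampled index, \<open>d i\<close> the selected subgradient and \<open>z i\<close> the inner iterate,
  with \<open>z N\<close> the output; only the values \<open>s i\<close>, \<open>d i\<close> with \<open>1 \<le> i \<le> N\<close> are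
  constrained. If the positive part vanishes at \<open>z (i - 1)\<close>, the coefficient of \<open>d i\<close> is
  \<open>0\<close> even for \<open>d i = 0\<close>, because \<open>0 / 0 = 0\<close>.\<close>

definition feasibility_run ::
  "nat \<Rightarrow> (nat \<Rightarrow> 'a::euclidean_space \<Rightarrow> real) \<Rightarrow> 'a set \<Rightarrow> real \<Rightarrow> 'a \<Rightarrow> nat \<Rightarrow>
    (nat \<Rightarrow> nat) \<Rightarrow> (nat \<Rightarrow> 'a) \<Rightarrow> (nat \<Rightarrow> 'a) \<Rightarrow> bool" where
  "feasibility_run m g Y \<beta> v N s d z \<longleftrightarrow>
     z 0 = v \<and>
     (\<forall>i\<in>{1..N}.
        s i \<in> {1..m} \<and>
        d i \<in> subdifferential (pos_part (g (s i))) (z (i - 1)) \<and>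
        z i = closest_point Y
          (z (i - 1) - (\<beta> * (pos_part (g (s i)) (z (i - 1)) / (norm (d i))\<^sup>2)) *\<^sub>R d i))"

text \<open>One realization of the outer method; \<open>gradf\<close> is the gradient map of the objective.\<close>

definition gradient_run ::
  "nat \<Rightarrow> (nat \<Rightarrow> 'a::euclidean_space \<Rightarrow> real) \<Rightarrow> 'a set \<Rightarrow> ('a \<Rightarrow> 'a) \<Rightarrow> (nat \<Rightarrow> real) \<Rightarrow> real \<Rightarrow>
    (nat \<Rightarrow> nat) \<Rightarrow> (nat \<Rightarrow> nat \<Rightarrow> nat) \<Rightarrow> (nat \<Rightarrow> nat \<Rightarrow> 'a) \<Rightarrow>
    (nat \<Rightarrow> 'a) \<Rightarrow> (nat \<Rightarrow> nat \<Rightarrow> 'a) \<Rightarrow> (nat \<Rightarrow> 'a) \<Rightarrow> bool" where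
  "gradient_run m g Y gradf \<alpha> \<beta> N s d v z x \<longleftrightarrow>
     x 0 \<in> Y \<and>
     (\<forall>k. v (k + 1) = closest_point Y (x k - \<alpha> k *\<^sub>R gradf (x k)) \<and>
          feasibility_run m g Y \<beta> (v (k + 1)) (N (k + 1)) (s (k + 1)) (d (k + 1)) (z (k + 1)) \<and>
          x (k + 1) = z (k + 1) (N (k + 1)))"

text \<open>The events determined before the \<open>i\<close>-th draw of outer step \<open>k\<close>: those generated by the
  initial point, by the iteration counts \<open>N\<^sub>1, \<dots>, N\<^sub>k\<close> and by the earlier draws. Since the
  counts may be random, a draw \<open>s t j\<close> is visible only on the event \<open>j \<le> N t\<close> on which it is
  actually made.\<close>

definition past_events ::
  "'w measure \<Rightarrow> ('w \<Rightarrow> 'a::topological_space) \<Rightarrow> (nat \<Rightarrow> 'w \<Rightarrow> nat) \<Rightarrow>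
    (nat \<Rightarrow> nat \<Rightarrow> 'w \<Rightarrow> nat) \<Rightarrow> nat \<Rightarrow> nat \<Rightarrow> 'w set set" where
  "past_events M x0 N s k i = sigma_sets (space M)
     ({x0 -` B \<inter> space M | B. B \<in> sets borel}
      \<union> {{w \<in> space M. N t w = c} | t c. 1 \<le> t \<and> t \<le> k}
      \<union> {{w \<in> space M. j \<le> N t w \<and> s t j w = r} | t j r.
            1 \<le> t \<and> 1 \<le> j \<and> (t < k \<or> t = k \<and> j < i)})"

text \<open>Whenever the draw \<open>s k i\<close> is made, its conditional law given the past is uniform on
  \<open>{1..m}\<close>.\<close>

definition uniform_sampling ::
  "'w measure \<Rightarrow> nat \<Rightarrow> ('w \<Rightarrow> 'a::topological_space) \<Rightarrow> (nat \<Rightarrow> 'w \<Rightarrow> nat) \<Rightarrow>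
    (nat \<Rightarrow> nat \<Rightarrow> 'w \<Rightarrow> nat) \<Rightarrow> bool" where
  "uniform_sampling M m x0 N s \<longleftrightarrow>
     (\<forall>k\<ge>1. \<forall>i\<ge>1. \<forall>r\<in>{1..m}.
        {w \<in> space M. i \<le> N k w \<and> s k i w = r} \<in> sets M \<and>
        (\<forall>A\<in>past_events M x0 N s k i.
           measure M (A \<inter> {w \<in> space M. i \<le> N k w \<and> s k i w = r}) =
           measure M (A \<inter> {w \<in> space M. i \<le> N k w}) / real m))"

end

theory Submission
  imports Defs
begin

text \<open>Fix a point \<open>p\<close> of \<open>X \<inter> Y\<close>. Smoothness and strong convexity give, for \<open>a = \<alpha>\<^sub>k\<close>,
  \<open>\<parallel>v\<^sub>k\<^sub>+\<^sub>1 - p\<parallel>\<^sup>2 \<le> (1 - a \<mu>) \<parallel>x\<^sub>k - p\<parallel>\<^sup>2 + 2 a (f p - f v\<^sub>k\<^sub>+\<^sub>1)\<close>, and strong convexity at \<open>p\<close>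
  bounds \<open>f p - f v\<^sub>k\<^sub>+\<^sub>1\<close> by \<open>\<parallel>\<nabla>f p\<parallel>\<^sup>2 / (2 \<mu>)\<close>. Hence every ball around \<open>p\<close> of radius at least
  \<open>\<parallel>\<nabla>f p\<parallel> / \<mu>\<close> is preserved by the gradient step; the feasibility steps do not increase the
  distance to \<open>p\<close>. So all iterates stay in one deterministic ball, where the subgradients of the
  finitely many convex functions involved are bounded.\<close>

text \<open>Restricting \<open>f\<close> to the line through \<open>x\<close> and \<open>y\<close>
  reduces this to the tangent inequality for a convex function of one real variable at 0, read off
  at 1. It turns a bound on subgradients of \<open>f\<close> into a bound on its gradient.\<close>

lemma gderiv_subdifferential:
  fixes f :: "'a::euclidean_space \<Rightarrow> real"
  assumes "convex_on UNIV f" and "GDERIV f x :> D"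
  shows "D \<in> subdifferential f x"
  unfolding subdifferential_def
proof safe
  fix y
  let ?l = "\<lambda>t. x + t *\<^sub>R (y - x)"
  have "convex_on UNIV (\<lambda>t. f (?l t))"
  proof (rule convex_onI)
    fix t a b :: real
    assume "0 < t" "t < 1"
    moreover have "?l ((1 - t) *\<^sub>R a + t *\<^sub>R b) = (1 - t) *\<^sub>R ?l a + t *\<^sub>R ?l b"
      by (simp add: algebra_simps)
    ultimately show "f (?l ((1 - t) *\<^sub>R a + t *\<^sub>R b)) \<le> (1 - t) * f (?l a) + t * f (?l b)"
      using convex_onD[OF assms(1), of t "?l a" "?l b"] by simp
  qed simp
  moreover have "((\<lambda>t. f (?l t)) has_real_derivative D \<bullet> (y - x)) (at 0)"
  proof -
    have f': "(f has_derivative (\<lambda>h. h \<bullet> D)) (at (?l 0))"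
      using assms(2) by (simp add: gderiv_def)
    have l: "(?l has_derivative (\<lambda>t. t *\<^sub>R (y - x))) (at 0)"
      by (auto intro!: derivative_eq_intros)
    have "((\<lambda>t. f (?l t)) has_derivative (\<lambda>t. (t *\<^sub>R (y - x)) \<bullet> D)) (at 0)"
      by (rule has_derivative_compose[OF l f'])
    then show ?thesis
      by (simp add: has_field_derivative_def inner_commute mult.commute[of _ "D \<bullet> (y - x)"])
  qed
  ultimately have "f (?l 1) - f (?l 0) \<ge> D \<bullet> (y - x) * (1 - 0)"
    by (intro convex_on_imp_above_tangent[where A = UNIV]) auto
  then show "f x + D \<bullet> (y - x) \<le> f y" by simp
qed

text \<open>The subgradient inequality, tested one unit away from \<open>x\<close> in the direction
  of \<open>d\<close>, bounds \<open>norm d\<close> by an increment of \<open>h\<close>. Both points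
  involved lie in the ball of radius \<open>R + 1\<close>, where the continuous function
  \<open>h\<close> is bounded by compactness.\<close>

lemma subgradients_bounded:
  fixes h :: "'a::euclidean_space \<Rightarrow> real"
  assumes "convex_on UNIV h"
  shows "\<exists>B. \<forall>x\<in>cball p R. \<forall>d\<in>subdifferential h x. norm d \<le> B"
proof -
  have "continuous_on (cball p (R + 1)) h"
    using convex_on_continuous[OF open_UNIV assms] continuous_on_subset by blast
  then have "bounded (h ` cball p (R + 1))"
    by (intro compact_imp_bounded compact_continuous_image) auto
  then obtain B where B: "\<And>y. y \<in> cball p (R + 1) \<Longrightarrow> \<bar>h y\<bar> \<le> B"
    by (auto simp del: mem_cball simp: bounded_iff)
  have "norm d \<le> 2 * B" if x: "x \<in> cball p R" and d: "d \<in> subdifferential h x" for x d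
  proof -
    let ?y = "x + sgn d"
    have "d \<bullet> sgn d = norm d"
      by (cases "d = 0") (simp_all add: sgn_div_norm dot_square_norm power2_eq_square)
    then have "h x + norm d \<le> h ?y"
      using d by (auto simp: subdifferential_def dest: spec[of _ ?y])
    moreover have "?y \<in> cball p (R + 1)"
    proof -
      have "dist p ?y \<le> dist p x + norm (sgn d)"
        using dist_triangle[of p ?y x] by (simp add: dist_norm)
      also have "norm (sgn d) \<le> 1" by (simp add: norm_sgn)
      finally show ?thesis using x by simp
    qed
    moreover have "x \<in> cball p (R + 1)" using x by simp
    ultimately show ?thesis using B[of x] B[of ?y] by linarith
  qed
  then show ?thesis by blast
qed

lemma subgradients_bounded_family:
  fixes h :: "'i \<Rightarrow> 'a::euclidean_space \<Rightarrow> real"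
  assumes "finite I" and "\<And>i. i \<in> I \<Longrightarrow> convex_on UNIV (h i)"
  shows "\<exists>B>0. \<forall>i\<in>I. \<forall>x\<in>cball p R. \<forall>d\<in>subdifferential (h i) x. norm d \<le> B"
proof -
  have "\<forall>i\<in>I. \<exists>B. \<forall>x\<in>cball p R. \<forall>d\<in>subdifferential (h i) x. norm d \<le> B"
    using subgradients_bounded[OF assms(2)] by blast
  then obtain b where
    b: "\<And>i x d. i \<in> I \<Longrightarrow> x \<in> cball p R \<Longrightarrow> d \<in> subdifferential (h i) x \<Longrightarrow> norm d \<le> b i"
    by metis
  \<comment> \<open>Absolute values are summed because a chosen \<open>b i\<close> may be negative
    when the ball is empty; the \<open>+ 1\<close> below makes the common bound strictly
    positive.\<close>
  have le: "b i \<le> (\<Sum>i\<in>I. \<bar>b i\<bar>)" if "i \<in> I" for i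
    using member_le_sum[of i I "\<lambda>i. \<bar>b i\<bar>"] assms(1) that by fastforce
  have "0 < (\<Sum>i\<in>I. \<bar>b i\<bar>) + 1" by (simp add: add_nonneg_pos)
  moreover have "norm d \<le> (\<Sum>i\<in>I. \<bar>b i\<bar>) + 1"
    if "i \<in> I" "x \<in> cball p R" "d \<in> subdifferential (h i) x" for i x d
    using b[OF that] le[OF that(1)] by linarith
  ultimately show ?thesis
    by (intro exI[of _ "(\<Sum>i\<in>I. \<bar>b i\<bar>) + 1"] conjI ballI) blast+
qed

lemma convex_on_pos_part:
  assumes "convex_on S h"
  shows "convex_on S (pos_part h)"
proof (rule convex_onI)
  fix t :: real and x y
  assume t: "0 < t" "t < 1" and "x \<in> S" "y \<in> S"
  then have "h ((1 - t) *\<^sub>R x + t *\<^sub>R y) \<le> (1 - t) * h x + t * h y"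
    using convex_onD[OF assms] by simp
  moreover have "(1 - t) * h x \<le> (1 - t) * max 0 (h x)" "t * h y \<le> t * max 0 (h y)"
    "0 \<le> (1 - t) * max 0 (h x)" "0 \<le> t * max 0 (h y)"
    using t by (auto intro: mult_left_mono)
  ultimately show "pos_part h ((1 - t) *\<^sub>R x + t *\<^sub>R y) \<le> (1 - t) * pos_part h x + t * pos_part h y"
    unfolding pos_part_def by linarith
qed (use assms convex_on_imp_convex in blast)

lemma norm_closest_point_diff_le:
  fixes Y :: "'a::euclidean_space set"
  assumes "closed Y" "convex Y" "p \<in> Y"
  shows "norm (closest_point Y u - p) \<le> norm (u - p)"
  using closest_point_lipschitz[of Y u p] assms closest_point_self[of p Y]
  by (force simp: dist_norm)

text \<open>With step length \<open>c\<close>, the squared distance to \<open>p\<close> changes by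
  -2 c (\<open>d\<close> . (\<open>z\<close> - \<open>p\<close>)) + c^2 |\<open>d\<close>|^2. The
  subgradient inequality at \<open>p\<close> gives \<open>d\<close> . (\<open>z\<close> -
  \<open>p\<close>) >= \<open>h z\<close>, and c |\<open>d\<close>|^2 = \<beta> \<open>h z\<close>,
  so the change is at most -(2 - \<beta>) c \<open>h z\<close>, which is not positive.\<close>

lemma subgradient_step_fejer:
  fixes z :: "'a::euclidean_space"
  assumes "0 \<le> \<beta>" "\<beta> \<le> 2" and "0 \<le> h z" "h p \<le> 0" and d: "d \<in> subdifferential h z"
  shows "norm (z - (\<beta> * (h z / (norm d)\<^sup>2)) *\<^sub>R d - p) \<le> norm (z - p)"
proof (cases "d = 0")
  case False
  define c where "c = \<beta> * (h z / (norm d)\<^sup>2)"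
  have c: "0 \<le> c" using assms by (simp add: c_def)
  have "h z \<le> d \<bullet> (z - p)"
    using d assms(4) by (auto simp: subdifferential_def inner_diff_right dest!: spec[of _ p])
  then have "2 * c * h z \<le> 2 * c * (d \<bullet> (z - p))"
    using c by (intro mult_left_mono) auto
  moreover have "c\<^sup>2 * (norm d)\<^sup>2 = \<beta> * c * h z"
    using False by (simp add: c_def power2_eq_square field_simps)
  moreover have "\<beta> * c * h z \<le> 2 * c * h z"
    using assms c by (intro mult_right_mono) auto
  moreover have "(norm (z - c *\<^sub>R d - p))\<^sup>2
      = (norm (z - p))\<^sup>2 - 2 * c * (d \<bullet> (z - p)) + c\<^sup>2 * (norm d)\<^sup>2"
    unfolding power2_norm_eq_inner
    by (simp add: inner_commute algebra_simps power2_eq_square)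
  ultimately have "(norm (z - c *\<^sub>R d - p))\<^sup>2 \<le> (norm (z - p))\<^sup>2" by linarith
  then show ?thesis unfolding c_def by (rule power2_le_imp_le) simp
qed simp

lemma feasibility_run_in_ball:
  fixes Y :: "'a::euclidean_space set"
  assumes "closed Y" "convex Y" and p: "p \<in> feasible_set m g \<inter> Y"
    and "0 \<le> \<beta>" "\<beta> \<le> 2"
    and run: "feasibility_run m g Y \<beta> v N s d z"
    and v: "v \<in> Y \<inter> cball p R"
    and "i \<le> N"
  shows "z i \<in> Y \<inter> cball p R"
  using \<open>i \<le> N\<close>
proof (induction i)
  case 0
  then show ?case using run v by (simp add: feasibility_run_def)
next
  case (Suc i)
  define h where "h = pos_part (g (s (Suc i)))"
  define u where "u = z i - (\<beta> * (h (z i) / (norm (d (Suc i)))\<^sup>2)) *\<^sub>R d (Suc i)"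
  have "Suc i \<in> {1..N}" using Suc.prems by simp
  then have s: "s (Suc i) \<in> {1..m}" and d: "d (Suc i) \<in> subdifferential h (z i)"
    and z: "z (Suc i) = closest_point Y u"
    using run unfolding feasibility_run_def h_def u_def by (metis diff_Suc_1)+
  \<comment> \<open>Feasibility of \<open>p\<close> makes the positive part of every constraint
    vanish there, so the same \<open>p\<close> serves whichever index is sampled.\<close>
  have "h p \<le> 0" "0 \<le> h (z i)"
    using p s by (auto simp: feasible_set_def h_def pos_part_def)
  then have "norm (u - p) \<le> norm (z i - p)"
    unfolding u_def using subgradient_step_fejer assms(4,5) d by blast
  then have "norm (z (Suc i) - p) \<le> norm (z i - p)"
    using norm_closest_point_diff_le[of Y p u] assms(1,2) p z by simp
  moreover have "z (Suc i) \<in> Y"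
    unfolding z using assms(1) p by (intro closest_point_in_set) auto
  ultimately show ?case using Suc by (simp add: dist_norm norm_minus_commute)
qed

text \<open>The squared distance of the new point to \<open>p\<close> is at most a convex
  combination, with weights 1 - \<open>a\<close> \<mu> and \<open>a\<close> \<mu>, of
  |\<open>x\<close> - \<open>p\<close>|^2 and \<open>R\<close>^2, so the radius does not grow. Since
  \<open>p\<close> need not minimize \<open>f\<close>, its gradient enters the lower bound on
  \<open>R\<close>.\<close>

lemma projected_gradient_step_in_ball:
  fixes Y :: "'a::euclidean_space set" and f :: "'a \<Rightarrow> real"
  assumes Y: "closed Y" "convex Y" and p: "p \<in> Y" and x: "x \<in> Y \<inter> cball p R"
    and smooth: "\<And>a b. a \<in> Y \<Longrightarrow> b \<in> Y \<Longrightarrow>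
      f b - f a \<le> gradf a \<bullet> (b - a) + L / 2 * (norm (b - a))\<^sup>2"
    and strong: "\<And>a b. a \<in> Y \<Longrightarrow> b \<in> Y \<Longrightarrow>
      f b - f a \<ge> gradf a \<bullet> (b - a) + \<mu> / 2 * (norm (b - a))\<^sup>2"
    and "\<mu> > 0" "L > 0" and a: "0 < a" "a \<le> 1 / L"
    and R: "norm (gradf p) / \<mu> \<le> R"
  shows "closest_point Y (x - a *\<^sub>R gradf x) \<in> Y \<inter> cball p R"
proof -
  define w where "w = closest_point Y (x - a *\<^sub>R gradf x)"
  have w: "w \<in> Y" unfolding w_def using closest_point_in_set Y p by blast
  have R0: "0 \<le> R" using R \<open>\<mu> > 0\<close> by (meson divide_nonneg_pos norm_ge_zero order_trans)
  have "norm (w - p) \<le> R"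
  proof (cases "w = p")
    case False
    \<comment> \<open>Comparing the two quadratic bounds yields \<mu> \<le> \<open>L\<close> only at
      two distinct points of \<open>Y\<close>; hence the case split.\<close>
    have "\<mu> / 2 * (norm (w - p))\<^sup>2 \<le> L / 2 * (norm (w - p))\<^sup>2"
      using smooth[OF p w] strong[OF p w] by linarith
    then have "\<mu> \<le> L" using False by simp
    have aL: "a * L \<le> 1" using a \<open>L > 0\<close> by (simp add: field_simps)
    moreover have "a * \<mu> \<le> a * L" using \<open>\<mu> \<le> L\<close> a by simp
    ultimately have am: "a * \<mu> \<le> 1" by linarith
    \<comment> \<open>The variational inequality of the projection; polarization turns it into the
      three squared distances of \<open>proj\<close>.\<close>
    have "(x - a *\<^sub>R gradf x - w) \<bullet> (p - w) \<le> 0"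
      unfolding w_def by (rule closest_point_dot) (use Y p in auto)
    then have proj: "2 * (a * (gradf x \<bullet> (w - p)))
        \<le> (norm (x - p))\<^sup>2 - (norm (w - p))\<^sup>2 - (norm (w - x))\<^sup>2"
      unfolding power2_norm_eq_inner
      by (simp add: inner_commute algebra_simps)
    \<comment> \<open>Smoothness from \<open>x\<close> to \<open>w\<close> minus strong convexity
      from \<open>x\<close> to \<open>p\<close>: \<open>f x\<close> cancels and the two linear terms
      merge.\<close>
    have "f w - f p \<le> gradf x \<bullet> (w - p) + L / 2 * (norm (w - x))\<^sup>2 - \<mu> / 2 * (norm (x - p))\<^sup>2"
      using smooth[of x w] strong[of x p] x w p
      by (simp add: inner_diff_right norm_minus_commute)
    then have "2 * a * (f w - f p) \<le> 2 * a *
        (gradf x \<bullet> (w - p) + L / 2 * (norm (w - x))\<^sup>2 - \<mu> / 2 * (norm (x - p))\<^sup>2)"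
      using a by (intro mult_left_mono) auto
    also have "\<dots> = 2 * (a * (gradf x \<bullet> (w - p))) + a * L * (norm (w - x))\<^sup>2
        - a * \<mu> * (norm (x - p))\<^sup>2"
      by (simp add: algebra_simps)
    \<comment> \<open>Since \<open>a * L\<close> is at most 1, the term -|\<open>w\<close> -
      \<open>x\<close>|^2 of \<open>proj\<close> absorbs the smoothness error.\<close>
    also have "\<dots> \<le> (1 - a * \<mu>) * (norm (x - p))\<^sup>2 - (norm (w - p))\<^sup>2"
      using proj mult_right_mono[OF aL, of "(norm (w - x))\<^sup>2"] by (simp add: algebra_simps)
    finally have descent:
      "(norm (w - p))\<^sup>2 \<le> (1 - a * \<mu>) * (norm (x - p))\<^sup>2 + 2 * a * (f p - f w)"
      by (simp add: algebra_simps)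
    have "f p - f w \<le> norm (gradf p) * norm (w - p) - \<mu> / 2 * (norm (w - p))\<^sup>2"
      using strong[OF p w] norm_cauchy_schwarz[of "- gradf p" "w - p"] by simp
    also have "\<dots> \<le> \<mu> * R * norm (w - p) - \<mu> / 2 * (norm (w - p))\<^sup>2"
      using mult_right_mono[of "norm (gradf p)" "\<mu> * R" "norm (w - p)"] R \<open>\<mu> > 0\<close>
      by (simp add: pos_divide_le_eq mult.commute)
    \<comment> \<open>Completing the square in \<open>norm (w - p)\<close> gives a bound independent
      of \<open>w\<close>.\<close>
    also have "\<dots> = \<mu> / 2 * (R\<^sup>2 - (R - norm (w - p))\<^sup>2)"
      by (simp add: power2_eq_square algebra_simps)
    also have "\<dots> \<le> \<mu> / 2 * R\<^sup>2"
      using \<open>\<mu> > 0\<close> by (intro mult_left_mono) auto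
    finally have "2 * a * (f p - f w) \<le> 2 * a * (\<mu> / 2 * R\<^sup>2)"
      using a by (intro mult_left_mono) auto
    then have "2 * a * (f p - f w) \<le> a * \<mu> * R\<^sup>2" by simp
    moreover have "(norm (x - p))\<^sup>2 \<le> R\<^sup>2"
      using x by (intro power_mono) (auto simp: dist_norm norm_minus_commute)
    then have "(1 - a * \<mu>) * (norm (x - p))\<^sup>2 \<le> (1 - a * \<mu>) * R\<^sup>2"
      using am by (intro mult_left_mono) auto
    ultimately have "(norm (w - p))\<^sup>2 \<le> R\<^sup>2"
      using descent by (simp add: algebra_simps)
    then show ?thesis using R0 by (rule power2_le_imp_le)
  qed (use R0 in simp)
  with w show ?thesis unfolding w_def by (simp add: dist_norm norm_minus_commute)
qed

theorem corollaryD2: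
  fixes M :: "'w measure"
    and f :: "real ^ 'n \<Rightarrow> real" and gradf :: "real ^ 'n \<Rightarrow> real ^ 'n"
    and m :: nat and g :: "nat \<Rightarrow> real ^ 'n \<Rightarrow> real" and Y :: "(real ^ 'n) set"
    and L \<mu> \<beta> M\<^sub>0 :: real and \<alpha> :: "nat \<Rightarrow> real"
    and N :: "nat \<Rightarrow> 'w \<Rightarrow> nat" and s :: "nat \<Rightarrow> nat \<Rightarrow> 'w \<Rightarrow> nat"
    and d z :: "nat \<Rightarrow> nat \<Rightarrow> 'w \<Rightarrow> real ^ 'n"
    and v x :: "nat \<Rightarrow> 'w \<Rightarrow> real ^ 'n"
  assumes "prob_space M"
    and "1 \<le> m"
    and "convex_on UNIV f"
    and "\<And>y. GDERIV f y :> gradf y"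
    and "\<And>i. i \<in> {1..m} \<Longrightarrow> convex_on UNIV (g i)"
    and "closed Y" and "convex Y" and "feasible_set m g \<inter> Y \<noteq> {}"
    and "L > 0"
    and "\<And>a b. a \<in> Y \<Longrightarrow> b \<in> Y \<Longrightarrow>
           f b - f a \<le> gradf a \<bullet> (b - a) + L / 2 * (norm (b - a))\<^sup>2"
    and "\<mu> > 0"
    and "\<And>a b. a \<in> Y \<Longrightarrow> b \<in> Y \<Longrightarrow>
           f b - f a \<ge> gradf a \<bullet> (b - a) + \<mu> / 2 * (norm (b - a))\<^sup>2"
    and "\<And>k. 0 < \<alpha> k \<and> \<alpha> k \<le> 1 / L"
    and "0 < \<beta>" and "\<beta> < 2"
    and "x 0 \<in> borel_measurable M"
    and "\<And>k. k \<ge> 1 \<Longrightarrow> N k \<in> measurable M (count_space UNIV)"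
    and "uniform_sampling M m (x 0) N s"
    and "\<And>w. w \<in> space M \<Longrightarrow>
           gradient_run m g Y gradf \<alpha> \<beta> (\<lambda>k. N k w) (\<lambda>k i. s k i w) (\<lambda>k i. d k i w)
             (\<lambda>k. v k w) (\<lambda>k i. z k i w) (\<lambda>k. x k w)"
    and "M\<^sub>0 > 0" and "\<And>w. w \<in> space M \<Longrightarrow> norm (x 0 w) \<le> M\<^sub>0"
  shows "\<exists>M\<^sub>g>0. \<exists>M\<^sub>f>0. \<forall>w\<in>space M.
           (\<forall>k\<ge>1. \<forall>i\<in>{1..N k w}. norm (d k i w) \<le> M\<^sub>g) \<and>
           (\<forall>k. norm (gradf (x k w)) \<le> M\<^sub>f)"
proof -
  note run = assms(19)[unfolded gradient_run_def]
  obtain p where p: "p \<in> feasible_set m g \<inter> Y" using assms(8) by blast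
  \<comment> \<open>The first term covers the initial point, the second is the threshold required by
    the gradient step. Neither depends on the realization \<open>w\<close>, so the final bounds are
    deterministic.\<close>
  define R where "R = max (M\<^sub>0 + norm p) (norm (gradf p) / \<mu>)"
  have iterates: "x k w \<in> Y \<inter> cball p R" and inputs: "v (Suc k) w \<in> Y \<inter> cball p R"
    if w: "w \<in> space M" for k w
  proof -
    have gradient_step: "v (Suc k) w \<in> Y \<inter> cball p R" if "x k w \<in> Y \<inter> cball p R" for k
      using run[OF w] projected_gradient_step_in_ball[OF assms(6,7) _ that assms(10,12,11,9)]
        assms(13)[of k] p
      by (simp add: R_def)
    have x_bound: "x k w \<in> Y \<inter> cball p R" for k
    proof (induction k)
      case 0
      have "dist p (x 0 w) \<le> M\<^sub>0 + norm p"
        using assms(21)[OF w] norm_triangle_ineq4[of p "x 0 w"] by (simp add: dist_norm)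
      then show ?case using run[OF w] by (simp add: R_def le_max_iff_disj)
    next
      case (Suc k)
      have "feasibility_run m g Y \<beta> (v (Suc k) w) (N (Suc k) w)
          (\<lambda>i. s (Suc k) i w) (\<lambda>i. d (Suc k) i w) (\<lambda>i. z (Suc k) i w)"
        and x: "x (Suc k) w = z (Suc k) (N (Suc k) w) w"
        using run[OF w] unfolding Suc_eq_plus1 by blast+
      then show ?case
        unfolding x using assms(14,15) gradient_step[OF Suc]
        by (intro feasibility_run_in_ball[OF assms(6,7) p]) auto
    qed
    show "x k w \<in> Y \<inter> cball p R" "v (Suc k) w \<in> Y \<inter> cball p R"
      using x_bound gradient_step by blast+
  qed
  obtain M\<^sub>g where M\<^sub>g: "M\<^sub>g > 0" "\<And>r y e. r \<in> {1..m} \<Longrightarrow> y \<in> cball p R \<Longrightarrow>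
      e \<in> subdifferential (pos_part (g r)) y \<Longrightarrow> norm e \<le> M\<^sub>g"
    using subgradients_bounded_family[of "{1..m}" "\<lambda>r. pos_part (g r)" p R]
      convex_on_pos_part[OF assms(5)] by auto
  \<comment> \<open>Gradients are subgradients of \<open>f\<close>, so the family bound over a
    one-element index set supplies a positive constant.\<close>
  obtain M\<^sub>f where M\<^sub>f: "M\<^sub>f > 0" "\<And>y. y \<in> cball p R \<Longrightarrow> norm (gradf y) \<le> M\<^sub>f"
    using subgradients_bounded_family[of "{()}" "\<lambda>_. f" p R] assms(3)
      gderiv_subdifferential[OF assms(3,4)] by auto
  have "norm (d k i w) \<le> M\<^sub>g" if w: "w \<in> space M" and "1 \<le> k" and i: "i \<in> {1..N k w}" for k i w
  proof -
    obtain j where k: "k = Suc j" using \<open>1 \<le> k\<close> by (cases k) auto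
    have fr: "feasibility_run m g Y \<beta> (v k w) (N k w) (\<lambda>i. s k i w) (\<lambda>i. d k i w) (\<lambda>i. z k i w)"
      using run[OF w] unfolding k Suc_eq_plus1 by blast
    \<comment> \<open>The subgradient \<open>d k i\<close> is taken at the preceding inner iterate,
      which for \<open>i = 1\<close> is the input \<open>v k\<close>.\<close>
    have "z k (i - 1) w \<in> cball p R"
      using feasibility_run_in_ball[OF assms(6,7) p _ _ fr, of R "i - 1"] inputs[OF w, of j]
        assms(14,15) i k by force
    then show ?thesis
      using fr i M\<^sub>g(2) unfolding feasibility_run_def by blast
  qed
  moreover have "norm (gradf (x k w)) \<le> M\<^sub>f" if "w \<in> space M" for k w
    using M\<^sub>f(2) iterates[OF that] by blast
  ultimately show ?thesis using M\<^sub>g(1) M\<^sub>f(1) by blast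
qed

end
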